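(* Let $W\in\mathbb{R}^{n\times n}$ be normalized diagonally dominant and invertible. Then there are constants $c_1>0$ and $0<c_2<1$ (depending only on $W$) such that the algorithm SS-Iterative associated with $W$ $\epsilon$-always converges with $$\epsilon(\Delta t,\delta,\mathcal{C})=\delta\cdot c_1+(c_2)^{\Delta t}\cdot\|O(r)-u\|_\infty ,$$ where $O(r)\in\mathbb{R}^n$ is the vector of values stored by the nodes in the starting configuration $\mathcal{C}$ and $u$ is the solution to the input $v$ around which the input sequence is bounded. Explicitly: for every $\delta\ge 0$, every $v\in\mathbb{R}^n$ with $u=W^{-1}v$, every input sequence $I(r+1),\dots,I(r+\ell)\in\mathbb{R}^n$ that is $\delta$-bounded around $v$, every initial vector $O(r)\in\mathbb{R}^n$, and every $1\le\Delta t\le \ell$, the output vector $O(r+\Delta t)$ produced by SS-Iterative satisfies $$\|O(r+\Delta t)-u\|_\infty\le \delta\cdot c_1+(c_2)^{\Delta t}\cdot\|O(r)-u\|_\infty .$$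
   Context: Setting: there are $n$ nodes $p_1,\dots,p_n$ with real weights $w_{p_i,p_j}$, where $w_{p_i,p_i}\neq 0$ for all $i$, and, for $i\ne j$, $w_{p_i,p_j}=0$ when there is no edge between $p_i$ and $p_j$. The matrix $W$ has entries $W_{ii}=1/w_{p_i,p_i}$ and $W_{ij}=-w_{p_i,p_j}/w_{p_i,p_i}$ for $i\ne j$. (Conversely, a matrix $W$ with nonzero diagonal determines the weights.) For an input vector $v\in\mathbb{R}^n$, the solution to $v$ is the unique $u\in\mathbb{R}^n$ with $u_i=w_{p_i,p_i}v_i+\sum_{j\ne i}w_{p_i,p_j}u_j$ for all $i$, equivalently $Wu=v$. A matrix $M\in\mathbb{R}^{n\times n}$ is diagonally dominant if $|M_{ii}|>\sum_{j\ne i}|M_{ij}|$ for every $i$. It is normalized diagonally dominant if it is diagonally dominant and $|M_{ii}|\ge 1$ for every $i$. Algorithm SS-Iterative (synchronous rounds): node $p_i$ stores one real value $O_{p_i}$. In each round it sends its stored value to all its neighbors, reads its current input $I_{p_i}$, and replaces its stored value (its output) by $w_{p_i,p_i}I_{p_i}$ plus the sum of $w_{p_i,p_j}$ times the value received from $p_j$, over all neighbors $p_j$. Writing $I(r)$ and $O(r)$ for the input and output vectors of round $r$, this means $$O_{p_i}(r+1)=w_{p_i,p_i}I_{p_i}(r+1)+\sum_{j\ne i}w_{p_i,p_j}O_{p_j}(r)\quad\text{for all } i .$$ The configuration at the start of round $r+1$ is the vector of stored values $O(r)$, which may be arbitrary. Norm: $\|x\|_\infty=\max_i|x_i|$. An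 input sequence is $\delta$-bounded around $v$ if each of its vectors $v'$ satisfies $\|v'-v\|_\infty\le\delta$. A run from configuration $\mathcal{C}$ on a $\delta$-bounded input sequence around $v$ $\epsilon$-converges to its solution if the output vector after $\Delta t$ rounds is at $\|\cdot\|_\infty$-distance at most $\epsilon(\Delta t,\delta,\mathcal{C})$ from the solution $u$ to $v$. An algorithm $\epsilon$-always converges if, for every $\delta$-bounded input sequence, every run on it (from any configuration) $\epsilon$-converges to its solution. *)

theory Defs
  imports "HOL-Analysis.Analysis"
begin

definition diagonally_dominant :: "real^'n^'n \<Rightarrow> bool" where
  "diagonally_dominant M \<longleftrightarrow> (\<forall>i. \<bar>M $ i $ i\<bar> > (\<Sum>j\<in>UNIV - {i}. \<bar>M $ i $ j\<bar>))"

definition normalized_diagonally_dominant :: "real^'n^'n \<Rightarrow> bool" where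
  "normalized_diagonally_dominant M \<longleftrightarrow> diagonally_dominant M \<and> (\<forall>i. \<bar>M $ i $ i\<bar> \<ge> 1)"

text \<open>Nodes are the elements of the finite type 'n; the weight of the ordered pair (i, j) is w i j.
  Edges are undirected, but w need not be symmetric, and an edge may carry weight 0.\<close>

definition is_network :: "('n \<Rightarrow> 'n \<Rightarrow> bool) \<Rightarrow> ('n \<Rightarrow> 'n \<Rightarrow> real) \<Rightarrow> bool" where
  "is_network E w \<longleftrightarrow> symp E \<and> irreflp E \<and> (\<forall>i. w i i \<noteq> 0) \<and>
     (\<forall>i j. i \<noteq> j \<and> \<not> E i j \<longrightarrow> w i j = 0)"

definition matrix_of_weights :: "('n \<Rightarrow> 'n \<Rightarrow> real) \<Rightarrow> real^'n^'n" where
  "matrix_of_weights w = (\<chi> i j. if i = j then 1 / w i i else - w i j / w i i)"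

definition weights_of_matrix :: "real^'n^'n \<Rightarrow> 'n \<Rightarrow> 'n \<Rightarrow> real" where
  "weights_of_matrix W i j = (if i = j then 1 / W $ i $ i else - W $ i $ j / W $ i $ i)"

definition is_solution :: "('n::finite \<Rightarrow> 'n \<Rightarrow> real) \<Rightarrow> real^'n \<Rightarrow> real^'n \<Rightarrow> bool" where
  "is_solution w v u \<longleftrightarrow> (\<forall>i. u $ i = w i i * v $ i + (\<Sum>j\<in>UNIV - {i}. w i j * u $ j))"

definition solution :: "('n::finite \<Rightarrow> 'n \<Rightarrow> real) \<Rightarrow> real^'n \<Rightarrow> real^'n" where
  "solution w v = (THE u. is_solution w v u)"

text \<open>A run of SS-Iterative over the rounds r + 1, ..., r + l, where Inp t and Out t are the
  input and output vectors of round t. The starting configuration is the vector Out r of stored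
  values, on which there is no constraint. Values outside these rounds are irrelevant.\<close>

definition ss_iterative_run ::
  "('n::finite \<Rightarrow> 'n \<Rightarrow> bool) \<Rightarrow> ('n \<Rightarrow> 'n \<Rightarrow> real) \<Rightarrow> nat \<Rightarrow> nat \<Rightarrow>
   (nat \<Rightarrow> real^'n) \<Rightarrow> (nat \<Rightarrow> real^'n) \<Rightarrow> bool" where
  "ss_iterative_run E w r l Inp Out \<longleftrightarrow>
     (\<forall>t. r \<le> t \<and> t < r + l \<longrightarrow>
       (\<forall>i. Out (t + 1) $ i = w i i * Inp (t + 1) $ i + (\<Sum>j\<in>{j. E i j}. w i j * Out t $ j)))"

text \<open>The norm of the vectors is the library's infnorm, which on real^'n is the
  maximum of the absolute values of the components.\<close>

definition delta_bounded ::
  "real \<Rightarrow> real^'n \<Rightarrow> nat \<Rightarrow> nat \<Rightarrow> (nat \<Rightarrow> real^'n) \<Rightarrow> bool" where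
  "delta_bounded \<delta> v r l Inp \<longleftrightarrow> (\<forall>t. r < t \<and> t \<le> r + l \<longrightarrow> infnorm (Inp t - v) \<le> \<delta>)"

text \<open>The bound eps takes the number of rounds, the input perturbation and the starting
  configuration; its last argument is the solution u, on which the bound may depend as well.\<close>

definition ss_iterative_always_converges ::
  "('n::finite \<Rightarrow> 'n \<Rightarrow> bool) \<Rightarrow> ('n \<Rightarrow> 'n \<Rightarrow> real) \<Rightarrow>
   (nat \<Rightarrow> real \<Rightarrow> real^'n \<Rightarrow> real^'n \<Rightarrow> real) \<Rightarrow> bool" where
  "ss_iterative_always_converges E w eps \<longleftrightarrow>
     (\<forall>\<delta> v r l Inp Out. \<delta> \<ge> 0 \<longrightarrow> delta_bounded \<delta> v r l Inp \<longrightarrow> ss_iterative_run E w r l Inp Out \<longrightarrow>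
        (\<forall>\<Delta>t. 1 \<le> \<Delta>t \<and> \<Delta>t \<le> l \<longrightarrow>
           infnorm (Out (r + \<Delta>t) - solution w v) \<le> eps \<Delta>t \<delta> (Out r) (solution w v)))"

lemma matrix_of_weights_of_matrix:
  assumes "\<And>i. W $ i $ i \<noteq> 0"
  shows "matrix_of_weights (weights_of_matrix W) = W"
  using assms by (simp add: matrix_of_weights_def weights_of_matrix_def vec_eq_iff)

lemma is_solution_iff:
  assumes "\<And>i. w i i \<noteq> 0"
  shows "is_solution w v u \<longleftrightarrow> matrix_of_weights w *v u = v"
proof -
  have "(u $ i = w i i * v $ i + (\<Sum>j\<in>UNIV - {i}. w i j * u $ j)) \<longleftrightarrow>
      (matrix_of_weights w *v u) $ i = v $ i" for i
  proof -
    have "(matrix_of_weights w *v u) $ i =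
        u $ i / w i i + (\<Sum>j\<in>UNIV - {i}. matrix_of_weights w $ i $ j * u $ j)"
      by (simp add: matrix_vector_mult_def sum.remove[of UNIV i] matrix_of_weights_def)
    also have "(\<Sum>j\<in>UNIV - {i}. matrix_of_weights w $ i $ j * u $ j) =
        - (\<Sum>j\<in>UNIV - {i}. w i j * u $ j) / w i i"
      by (simp add: sum_divide_distrib flip: sum_negf)
        (rule sum.cong, auto simp: matrix_of_weights_def)
    finally show ?thesis
      using assms[of i] by (auto simp: field_simps)
  qed
  then show ?thesis
    by (simp add: is_solution_def vec_eq_iff)
qed

lemma solution_eq_matrix_inv:
  assumes "\<And>i. W $ i $ i \<noteq> 0" and "invertible W"
  shows "solution (weights_of_matrix W) v = matrix_inv W *v v"
proof -
  have "is_solution (weights_of_matrix W) v u \<longleftrightarrow> W *v u = v" for u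
    using assms(1) is_solution_iff[of "weights_of_matrix W"]
    by (simp add: matrix_of_weights_of_matrix) (simp add: weights_of_matrix_def)
  moreover have "W ** matrix_inv W = mat 1 \<and> matrix_inv W ** W = mat 1"
    using assms(2) unfolding invertible_def matrix_inv_def by (rule someI_ex)
  then have "W *v u = v \<longleftrightarrow> u = matrix_inv W *v v" for u
    by (auto simp: matrix_vector_mul_assoc)
  ultimately show ?thesis
    by (simp add: solution_def)
qed

end

theory Submission
  imports Defs
begin

text \<open>Off the diagonal, the weight matrix has absolute row sums at most some c < 1 (diagonal
  dominance), and its diagonal weights are bounded by 1 (normalization). Subtracting the fixed-point
  equation of the solution from the update rule, each round maps an error e to at most
  \<delta> + c e; iterating gives the geometric series bound \<delta> / (1 - c) + c^\<Delta>t e.\<close>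

lemma infnorm_le_iff_cart:
  fixes x :: "real^'n"
  shows "infnorm x \<le> b \<longleftrightarrow> (\<forall>i. \<bar>x $ i\<bar> \<le> b)"
proof
  assume "infnorm x \<le> b"
  then show "\<forall>i. \<bar>x $ i\<bar> \<le> b"
    using component_le_infnorm_cart[of x] order_trans by blast
next
  assume "\<forall>i. \<bar>x $ i\<bar> \<le> b"
  then show "infnorm x \<le> b"
    by (auto simp: infnorm_Max Basis_vec_def inner_axis)
qed

text \<open>The value \<open>b / (1 - c)\<close> is the fixed point of the map taking x to
  \<open>b + c * x\<close>, so one step reproduces this term and multiplies the other by
  \<open>c\<close>. As it is nonnegative, the bound holds at the start.\<close>

lemma affine_recurrence_bound:
  fixes a :: "nat \<Rightarrow> real"
  assumes c: "0 \<le> c" "c < 1" and b: "0 \<le> b"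
    and step: "\<And>k. k < l \<Longrightarrow> a (Suc k) \<le> b + c * a k"
    and "k \<le> l"
  shows "a k \<le> b / (1 - c) + c ^ k * a 0"
  using \<open>k \<le> l\<close>
proof (induction k)
  case 0
  then show ?case using c b by simp
next
  case (Suc k)
  then have "a (Suc k) \<le> b + c * a k"
    using step by simp
  also have "\<dots> \<le> b + c * (b / (1 - c) + c ^ k * a 0)"
    using Suc c by (intro add_left_mono mult_left_mono) auto
  also have "\<dots> = b / (1 - c) + c ^ Suc k * a 0"
    using c by (simp add: field_simps)
  finally show ?case .
qed

lemma normalized_diagonally_dominant_nonzero:
  assumes "normalized_diagonally_dominant W"
  shows "W $ i $ i \<noteq> 0"
  using assms by (force simp: normalized_diagonally_dominant_def dest: spec[of _ i])

lemma abs_diagonal_weight_le_1: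
  assumes "normalized_diagonally_dominant W"
  shows "\<bar>weights_of_matrix W i i\<bar> \<le> 1"
  using assms by (auto simp: normalized_diagonally_dominant_def weights_of_matrix_def divide_le_eq_1)

text \<open>Off-diagonal weights are matrix entries divided by the diagonal entry of their row, so
  strict dominance of the row becomes a sum below 1.\<close>

lemma diagonally_dominant_row_sum_less_1:
  assumes "diagonally_dominant W"
  shows "(\<Sum>j\<in>UNIV - {i}. \<bar>weights_of_matrix W i j\<bar>) < 1"
proof -
  have "(\<Sum>j\<in>UNIV - {i}. \<bar>weights_of_matrix W i j\<bar>)
      = (\<Sum>j\<in>UNIV - {i}. \<bar>W $ i $ j\<bar>) / \<bar>W $ i $ i\<bar>"
    by (auto simp: weights_of_matrix_def sum_divide_distrib intro!: sum.cong)
  moreover have "(\<Sum>j\<in>UNIV - {i}. \<bar>W $ i $ j\<bar>) < \<bar>W $ i $ i\<bar>"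
    using assms by (simp add: diagonally_dominant_def)
  ultimately show ?thesis
    by (simp add: divide_less_eq_1)
qed

text \<open>There are finitely many rows, so the strict bounds for the single rows give one
  contraction factor that is still below 1.\<close>

lemma uniform_row_sum_bound:
  fixes W :: "real^'n^'n"
  assumes "diagonally_dominant W"
  obtains c where "0 < c" "c < 1"
    "\<And>i. (\<Sum>j\<in>UNIV - {i}. \<bar>weights_of_matrix W i j\<bar>) \<le> c"
proof
  let ?s = "\<lambda>i. \<Sum>j\<in>UNIV - {i}. \<bar>weights_of_matrix W i j\<bar>"
  \<comment> \<open>All row sums are 0 when \<open>W\<close> is diagonal; the extra
    \<open>1/2\<close> keeps the factor positive, as required of \<open>c2\<close>.\<close>
  let ?c = "Max (insert (1/2) (range ?s))"
  have "1/2 \<le> ?c" by (rule Max_ge) auto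
  then show "0 < ?c" by linarith
  show "?c < 1"
    using diagonally_dominant_row_sum_less_1[OF assms] by (subst Max_less_iff) auto
  show "?s i \<le> ?c" for i
    by (rule Max_ge) auto
qed

text \<open>\<open>solution\<close> is a definite description; it denotes an actual solution because
  invertibility makes \<open>matrix_inv W *v v\<close> the only candidate and one that
  works.\<close>

lemma is_solution_solution:
  assumes "\<And>i. W $ i $ i \<noteq> 0" and "invertible W"
  shows "is_solution (weights_of_matrix W) v (solution (weights_of_matrix W) v)"
proof -
  have "W ** matrix_inv W = mat 1"
    using assms(2) unfolding invertible_def matrix_inv_def by (rule someI2_ex) simp
  then have "W *v solution (weights_of_matrix W) v = v"
    by (simp add: solution_eq_matrix_inv assms matrix_vector_mul_assoc)
  moreover have "weights_of_matrix W i i \<noteq> 0" for i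
    using assms(1) by (simp add: weights_of_matrix_def)
  ultimately show ?thesis
    by (simp add: is_solution_iff matrix_of_weights_of_matrix assms(1))
qed

text \<open>The algorithm sums over neighbors, the solution over all other nodes. The sums agree:
  weights vanish on non-edges, and irreflexivity of \<open>E\<close> keeps \<open>i\<close> out of
  its own neighborhood.\<close>

lemma ss_iterative_run_step:
  assumes "is_network E w" "ss_iterative_run E w r l Inp Out" "r \<le> t" "t < r + l"
  shows "Out (t + 1) $ i = w i i * Inp (t + 1) $ i + (\<Sum>j\<in>UNIV - {i}. w i j * Out t $ j)"
proof -
  have "(\<Sum>j\<in>{j. E i j}. w i j * Out t $ j) = (\<Sum>j\<in>UNIV - {i}. w i j * Out t $ j)"
    using assms(1) by (intro sum.mono_neutral_left) (auto simp: is_network_def dest: irreflpD)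
  then show ?thesis
    using assms by (simp add: ss_iterative_run_def)
qed

text \<open>In each component of the difference, the input deviation is scaled by a diagonal weight
  of absolute value at most 1, and the old errors by weights whose absolute values sum to at most
  \<open>c\<close>.\<close>

lemma update_error_bound:
  fixes x y u v v' :: "real^'n"
  assumes diag: "\<And>i. \<bar>w i i\<bar> \<le> 1"
    and row: "\<And>i. (\<Sum>j\<in>UNIV - {i}. \<bar>w i j\<bar>) \<le> c"
    and sol: "is_solution w v u"
    and upd: "\<And>i. y $ i = w i i * v' $ i + (\<Sum>j\<in>UNIV - {i}. w i j * x $ j)"
  shows "infnorm (y - u) \<le> infnorm (v' - v) + c * infnorm (x - u)"
  unfolding infnorm_le_iff_cart
proof
  fix i
  have "(y - u) $ i = w i i * (v' - v) $ i + (\<Sum>j\<in>UNIV - {i}. w i j * (x - u) $ j)"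
    unfolding vector_minus_component upd[of i] sol[unfolded is_solution_def, rule_format, of i]
    by (simp add: right_diff_distrib sum_subtractf)
  also have "\<bar>\<dots>\<bar> \<le> \<bar>w i i\<bar> * \<bar>(v' - v) $ i\<bar> + (\<Sum>j\<in>UNIV - {i}. \<bar>w i j\<bar> * \<bar>(x - u) $ j\<bar>)"
    by (intro order_trans[OF abs_triangle_ineq] add_mono order_trans[OF sum_abs])
      (simp_all only: abs_mult order_refl)
  also have "\<dots> \<le> 1 * infnorm (v' - v) + (\<Sum>j\<in>UNIV - {i}. \<bar>w i j\<bar> * infnorm (x - u))"
    using diag by (intro add_mono mult_mono sum_mono mult_left_mono component_le_infnorm_cart) auto
  also have "\<dots> \<le> infnorm (v' - v) + c * infnorm (x - u)"
    using row[of i] by (simp add: infnorm_pos_le mult_right_mono flip: sum_distrib_right)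
  finally show "\<bar>(y - u) $ i\<bar> \<le> infnorm (v' - v) + c * infnorm (x - u)" .
qed

theorem theorem1:
  fixes W :: "real^'n^'n"
  assumes "normalized_diagonally_dominant W"
    and "invertible W"
  shows "\<exists>c1 c2. 0 < c1 \<and> 0 < c2 \<and> c2 < 1 \<and>
    (\<forall>E. is_network E (weights_of_matrix W) \<longrightarrow>
      ss_iterative_always_converges E (weights_of_matrix W)
        (\<lambda>\<Delta>t \<delta> C u. \<delta> * c1 + c2 ^ \<Delta>t * infnorm (C - u)))"
proof -
  let ?w = "weights_of_matrix W"
  have "diagonally_dominant W"
    using assms(1) by (simp add: normalized_diagonally_dominant_def)
  then obtain c where c: "0 < c" "c < 1" and row: "\<And>i. (\<Sum>j\<in>UNIV - {i}. \<bar>?w i j\<bar>) \<le> c"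
    using uniform_row_sum_bound by blast
  \<comment> \<open>The constants \<open>1 / (1 - c)\<close> and \<open>c\<close> are fixed before
    \<open>E\<close>, so they serve every network carrying these weights.\<close>
  have "ss_iterative_always_converges E ?w
      (\<lambda>\<Delta>t \<delta> C u. \<delta> * (1 / (1 - c)) + c ^ \<Delta>t * infnorm (C - u))"
    if net: "is_network E ?w" for E
    unfolding ss_iterative_always_converges_def
  proof (intro allI impI, elim conjE)
    fix \<delta> :: real and v :: "real^'n" and r l Inp Out \<Delta>t
    assume \<delta>: "\<delta> \<ge> 0" and bdd: "delta_bounded \<delta> v r l Inp"
      and run: "ss_iterative_run E ?w r l Inp Out" and \<Delta>t: "\<Delta>t \<le> l"
    let ?u = "solution ?w v"
    have sol: "is_solution ?w v ?u"
      using is_solution_solution normalized_diagonally_dominant_nonzero assms by blast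
    \<comment> \<open>Passing from \<open>k\<close> to \<open>Suc k\<close> reads the input of round
      \<open>r + k + 1\<close>, which lies in the bounded range exactly because
      \<open>k < l\<close>.\<close>
    have "infnorm (Out (r + Suc k) - ?u) \<le> \<delta> + c * infnorm (Out (r + k) - ?u)" if "k < l" for k
    proof -
      have "infnorm (Out (r + k + 1) - ?u)
          \<le> infnorm (Inp (r + k + 1) - v) + c * infnorm (Out (r + k) - ?u)"
        by (rule update_error_bound[OF abs_diagonal_weight_le_1[OF assms(1)] row sol])
          (use ss_iterative_run_step[OF net run] that in simp)
      moreover have "infnorm (Inp (r + k + 1) - v) \<le> \<delta>"
        using bdd that by (simp add: delta_bounded_def)
      ultimately show ?thesis by simp
    qed
    then show "infnorm (Out (r + \<Delta>t) - ?u)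
        \<le> \<delta> * (1 / (1 - c)) + c ^ \<Delta>t * infnorm (Out r - ?u)"
      using affine_recurrence_bound[of c \<delta> l "\<lambda>k. infnorm (Out (r + k) - ?u)" \<Delta>t] c \<delta> \<Delta>t
      by simp
  qed
  then show ?thesis
    using c by (intro exI[of _ "1 / (1 - c)"] exI[of _ c]) simp
qed

end
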